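(* Let $0<\alpha\le 1$ and let $f:[a,b]\to\mathbb{R}^\alpha$ be a generalized convex function on $[a,b]$. Then for any $x_i\in[a,b]$ and $\lambda_i\in[0,1]$ ($i=1,2,\dots,n$) with $\sum_{i=1}^n\lambda_i=1$, we have $$f\left(\sum_{i=1}^n\lambda_i x_i\right)\le\sum_{i=1}^n\lambda_i^\alpha f(x_i).$$
   Context: For $0<\alpha\le1$, $\mathbb{R}^\alpha$ denotes the $\alpha$-type set of real line numbers: its elements are the symbols $a^\alpha$ with $a\in\mathbb{R}$, with operations $a^\alpha+b^\alpha=(a+b)^\alpha$ and $a^\alpha b^\alpha=(ab)^\alpha$. These are commutative and associative, multiplication distributes over addition, $0^\alpha$ is the additive identity and $1^\alpha$ is the multiplicative identity. Order: $a^\alpha\le b^\alpha$ iff $a\le b$. A function $f:I\subseteq\mathbb{R}\to\mathbb{R}^\alpha$ ($I$ an interval) is called a generalized convex function on $I$ if for all $x_1,x_2\in I$ and $\lambda\in[0,1]$, $f(\lambda x_1+(1-\lambda)x_2)\le\lambda^\alpha f(x_1)+(1-\lambda)^\alpha f(x_2)$, where the products and sum on the right are taken in $\mathbb{R}^\alpha$. *)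

theory Defs
  imports "HOL-Algebra.Ring" "HOL-Analysis.Topology_Euclidean_Space"
begin

text \<open>The element \<open>a \<up> \<alpha>\<close> is the formal symbol \<open>a\<^sup>\<alpha>\<close>; it is not the real
  number \<open>a powr \<alpha>\<close>.  The exponent is part of the symbol.\<close>

datatype alpha_symbol = Alpha_Symbol (base: real) (expo: real)  (infix \<open>\<up>\<close> 80)

text \<open>The ring \<open>\<real>\<^sup>\<alpha>\<close>.  Outside the carrier, i.e. on symbols with another exponent, the
  operations have no significance.\<close>

definition Ralpha :: "real \<Rightarrow> alpha_symbol ring" where
  "Ralpha \<alpha> = \<lparr>carrier = {a \<up> \<alpha> | a. True},
     mult = (\<lambda>u v. (base u * base v) \<up> \<alpha>),
     one = 1 \<up> \<alpha>,
     zero = 0 \<up> \<alpha>,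
     add = (\<lambda>u v. (base u + base v) \<up> \<alpha>)\<rparr>"

definition alpha_le :: "alpha_symbol \<Rightarrow> real \<Rightarrow> alpha_symbol \<Rightarrow> bool"
  (\<open>(_/ \<sqsubseteq>\<^bsub>_\<^esub> _)\<close> [51, 0, 51] 50) where
  "u \<sqsubseteq>\<^bsub>\<alpha>\<^esub> v \<longleftrightarrow> (\<exists>a b. u = a \<up> \<alpha> \<and> v = b \<up> \<alpha> \<and> a \<le> b)"

definition generalized_convex_on :: "real \<Rightarrow> real set \<Rightarrow> (real \<Rightarrow> alpha_symbol) \<Rightarrow> bool" where
  "generalized_convex_on \<alpha> I f \<longleftrightarrow>
     is_interval I \<and> f \<in> I \<rightarrow> carrier (Ralpha \<alpha>) \<and>
     (\<forall>x1\<in>I. \<forall>x2\<in>I. \<forall>l\<in>{0..1}.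
        f (l * x1 + (1 - l) * x2) \<sqsubseteq>\<^bsub>\<alpha>\<^esub>
          (l \<up> \<alpha> \<otimes>\<^bsub>Ralpha \<alpha>\<^esub> f x1) \<oplus>\<^bsub>Ralpha \<alpha>\<^esub> ((1 - l) \<up> \<alpha> \<otimes>\<^bsub>Ralpha \<alpha>\<^esub> f x2))"

lemma Ralpha_simps:
  "carrier (Ralpha \<alpha>) = {a \<up> \<alpha> | a. True}"
  "a \<up> \<alpha> \<otimes>\<^bsub>Ralpha \<alpha>\<^esub> b \<up> \<alpha> = (a * b) \<up> \<alpha>"
  "a \<up> \<alpha> \<oplus>\<^bsub>Ralpha \<alpha>\<^esub> b \<up> \<alpha> = (a + b) \<up> \<alpha>"
  "\<one>\<^bsub>Ralpha \<alpha>\<^esub> = 1 \<up> \<alpha>"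
  "\<zero>\<^bsub>Ralpha \<alpha>\<^esub> = 0 \<up> \<alpha>"
  by (simp_all add: Ralpha_def)

lemma alpha_le_iff: "a \<up> \<alpha> \<sqsubseteq>\<^bsub>\<alpha>\<^esub> b \<up> \<alpha> \<longleftrightarrow> a \<le> b"
  by (simp add: alpha_le_def)

text \<open>This makes finite sums \<open>\<Oplus>\<^bsub>Ralpha \<alpha>\<^esub>\<close> of carrier elements the iterated addition
  of \<open>\<real>\<^sup>\<alpha>\<close>.\<close>

lemma cring_Ralpha: "cring (Ralpha \<alpha>)"
proof (rule cringI)
  show "abelian_group (Ralpha \<alpha>)"
  proof (rule abelian_groupI)
    fix u assume "u \<in> carrier (Ralpha \<alpha>)"
    then obtain a where "u = a \<up> \<alpha>" by (auto simp: Ralpha_simps)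
    then have "(- a) \<up> \<alpha> \<oplus>\<^bsub>Ralpha \<alpha>\<^esub> u = \<zero>\<^bsub>Ralpha \<alpha>\<^esub>" by (simp add: Ralpha_simps)
    then show "\<exists>v\<in>carrier (Ralpha \<alpha>). v \<oplus>\<^bsub>Ralpha \<alpha>\<^esub> u = \<zero>\<^bsub>Ralpha \<alpha>\<^esub>"
      by (auto simp: Ralpha_simps(1))
  qed (auto simp: Ralpha_simps)
  show "comm_monoid (Ralpha \<alpha>)"
    by (rule comm_monoidI) (auto simp: Ralpha_simps)
qed (auto simp: Ralpha_simps algebra_simps)

end

theory Submission
  imports Defs "HOL-Analysis.Convex_Euclidean_Space"
begin

text \<open>The map \<open>a \<mapsto> a \<up> \<alpha>\<close> is an isomorphism of ordered rings from \<open>\<real>\<close> onto \<open>\<real>\<^sup>\<alpha>\<close>, with inverse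
  \<^const>\<open>base\<close>.  It carries generalized convexity to ordinary convexity, and Jensen's inequality for
  \<open>base \<circ> f\<close> to the claim.\<close>

text \<open>Adding symbols adds their bases, so induction on \<open>A\<close> turns the sum in
  \<open>Ralpha \<alpha>\<close> into a real sum; every term lies in the carrier.\<close>

lemma finsum_Ralpha:
  assumes "finite A"
  shows "(\<Oplus>\<^bsub>Ralpha \<alpha>\<^esub>i\<in>A. g i \<up> \<alpha>) = (\<Sum>i\<in>A. g i) \<up> \<alpha>"
proof -
  interpret cring "Ralpha \<alpha>" by (rule cring_Ralpha)
  show ?thesis
    using assms by induction (simp_all add: Ralpha_simps Pi_def)
qed

text \<open>Values of \<open>f\<close> on \<open>I\<close> lie in the carrier, hence have exponent
  \<open>\<alpha>\<close> and are determined by their bases.\<close>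

lemma generalized_convex_on_eq:
  assumes "generalized_convex_on \<alpha> I f" and "x \<in> I"
  shows "f x = base (f x) \<up> \<alpha>"
  using assms by (auto simp: generalized_convex_on_def Ralpha_simps dest!: funcset_mem)

lemma generalized_convex_on_imp_convex_on:
  assumes f: "generalized_convex_on \<alpha> I f"
  shows "convex_on I (base \<circ> f)"
proof -
  have I: "convex I"
    using f by (simp add: generalized_convex_on_def is_interval_convex)
  have "base (f (u * x + v * y)) \<le> u * base (f x) + v * base (f y)"
    if "x \<in> I" "y \<in> I" "0 \<le> u" "0 \<le> v" "u + v = 1" for x y u v
  proof -
    have v: "v = 1 - u" using that by simp
    have "u * x + v * y \<in> I"
      using convexD[OF I that] by simp
    \<comment> \<open>Once all three values are symbols with exponent \<open>\<alpha>\<close>, the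
      defining inequality becomes one between real bases.\<close>
    with that obtain c d e where "f (u * x + v * y) = c \<up> \<alpha>" "f x = d \<up> \<alpha>" "f y = e \<up> \<alpha>"
      by (metis generalized_convex_on_eq[OF f])
    moreover have "f (u * x + v * y) \<sqsubseteq>\<^bsub>\<alpha>\<^esub>
        (u \<up> \<alpha> \<otimes>\<^bsub>Ralpha \<alpha>\<^esub> f x) \<oplus>\<^bsub>Ralpha \<alpha>\<^esub> (v \<up> \<alpha> \<otimes>\<^bsub>Ralpha \<alpha>\<^esub> f y)"
      using f that unfolding generalized_convex_on_def v by simp
    ultimately show ?thesis
      by (simp add: Ralpha_simps alpha_le_iff)
  qed
  then show ?thesis
    using I by (auto simp: convex_on_def)
qed

theorem theorem4p1:
  fixes \<alpha> a b :: real
    and f :: "real \<Rightarrow> alpha_symbol"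
    and n :: nat
    and x l :: "nat \<Rightarrow> real"
  assumes "0 < \<alpha>" and "\<alpha> \<le> 1"
    and "generalized_convex_on \<alpha> {a..b} f"
    and "\<And>i. i \<in> {1..n} \<Longrightarrow> x i \<in> {a..b}"
    and "\<And>i. i \<in> {1..n} \<Longrightarrow> l i \<in> {0..1}"
    and "(\<Sum>i=1..n. l i) = 1"
  shows "f (\<Sum>i=1..n. l i * x i) \<sqsubseteq>\<^bsub>\<alpha>\<^esub>
    (\<Oplus>\<^bsub>Ralpha \<alpha>\<^esub>i\<in>{1..n}. l i \<up> \<alpha> \<otimes>\<^bsub>Ralpha \<alpha>\<^esub> f (x i))"
proof -
  interpret cring "Ralpha \<alpha>" by (rule cring_Ralpha)
  let ?I = "{1..n}" and ?s = "\<Sum>i=1..n. l i * x i"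
  have scaled: "l i \<up> \<alpha> \<otimes>\<^bsub>Ralpha \<alpha>\<^esub> f (x i) = (l i * base (f (x i))) \<up> \<alpha>" if "i \<in> ?I" for i
    by (subst generalized_convex_on_eq[OF assms(3) assms(4)[OF that]]) (simp add: Ralpha_simps)
  have "(\<Oplus>\<^bsub>Ralpha \<alpha>\<^esub>i\<in>?I. l i \<up> \<alpha> \<otimes>\<^bsub>Ralpha \<alpha>\<^esub> f (x i))
      = (\<Oplus>\<^bsub>Ralpha \<alpha>\<^esub>i\<in>?I. (l i * base (f (x i))) \<up> \<alpha>)"
    by (rule finsum_cong') (auto simp: scaled Ralpha_simps(1))
  also have "\<dots> = (\<Sum>i\<in>?I. l i * base (f (x i))) \<up> \<alpha>"
    by (simp add: finsum_Ralpha)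
  finally have sum: "(\<Oplus>\<^bsub>Ralpha \<alpha>\<^esub>i\<in>?I. l i \<up> \<alpha> \<otimes>\<^bsub>Ralpha \<alpha>\<^esub> f (x i))
      = (\<Sum>i\<in>?I. l i * base (f (x i))) \<up> \<alpha>" .
  \<comment> \<open>The case \<open>n = 0\<close> is excluded: an empty sum of weights would be 0,
    not 1.\<close>
  have "?I \<noteq> {}"
    using assms(6) by (metis sum.empty zero_neq_one)
  then have jensen: "base (f ?s) \<le> (\<Sum>i\<in>?I. l i * base (f (x i)))"
    using convex_on_sum[of ?I "{a..b}" "base \<circ> f" l x] assms
      generalized_convex_on_imp_convex_on[OF assms(3)] by simp
  \<comment> \<open>Jensen's inequality compares bases only. As the interval is convex, it contains
    \<open>?s\<close>, so \<open>f ?s\<close> also has exponent \<open>\<alpha>\<close>, as the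
    order of \<open>Ralpha \<alpha>\<close> demands.\<close>
  have "?s \<in> {a..b}"
    using convex_sum[of ?I "{a..b}" l x] assms by simp
  then have "f ?s = base (f ?s) \<up> \<alpha>"
    by (rule generalized_convex_on_eq[OF assms(3)])
  with sum jensen show ?thesis
    by (metis alpha_le_iff)
qed

end
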